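(* Let $F$ be a complete holomorphic vector field on $\mathbb{C}^n$ with a globally attracting fixed point at the origin. Let $\Omega\subset\mathbb{C}^n$ be a domain containing the origin and invariant under the positive-time flow of $F$, that is, $X_t(\Omega)\subset\Omega$ for every $t\ge 0$, where $X_t$ is the flow of $F$. Then $\Omega$ is a Runge domain.
   Context: A domain is a connected open set. A holomorphic vector field on $\mathbb{C}^n$ is identified with a holomorphic map $F:\mathbb{C}^n\to\mathbb{C}^n$; its flow $X_t$ solves $\frac{d}{dt}X_t(z)=F(X_t(z))$, $X_0(z)=z$. Complete means that the flow is defined for all complex times $t\in\mathbb{C}$; its restriction to $t\in\mathbb{R}$ is the real-time flow. The origin is a globally attracting fixed point if it is a globally asymptotically stable equilibrium of the real-time flow: $F(0)=0$, the origin is Lyapunov stable (for every $r>0$ there is $\delta>0$ with $\|X_t(z)\|<r$ for all $\|z\|<\delta$ and $t\ge 0$), and $X_t(z)\to 0$ as $t\to+\infty$ for every $z\in\mathbb{C}^n$. A domain $\Omega\subset\mathbb{C}^n$ is Runge if every holomorphic function on $\Omega$ can be approximated, uniformly on compact subsets of $\Omega$, by holomorphic polynomials. *)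

theory Defs
  imports "HOL-Complex_Analysis.Complex_Analysis"
begin

text \<open>
  A function is holomorphic if it is Frechet differentiable with a complex-linear derivative.
  As with the one-variable \<^const>\<open>holomorphic_on\<close>, differentiability is taken within the set;
  this is the usual notion when the set is open.
\<close>

definition holomorphic_fun_on :: "(complex^'n \<Rightarrow> complex) \<Rightarrow> (complex^'n) set \<Rightarrow> bool" where
  "holomorphic_fun_on f S \<longleftrightarrow>
     (\<forall>z\<in>S. \<exists>D. (f has_derivative D) (at z within S) \<and> (\<forall>c v. D (c *s v) = c * D v))"

definition holomorphic_map_on ::
    "(complex^'n \<Rightarrow> complex^'m) \<Rightarrow> (complex^'n) set \<Rightarrow> bool" where
  "holomorphic_map_on F S \<longleftrightarrow> (\<forall>i. holomorphic_fun_on (\<lambda>z. F z $ i) S)"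

text \<open>
  The set \<open>A\<close> consists of multi-indices; distinct multi-indices give distinct monomials.
\<close>

definition polynomial_fun :: "(complex^'n \<Rightarrow> complex) \<Rightarrow> bool" where
  "polynomial_fun p \<longleftrightarrow>
     (\<exists>(A :: ('n \<Rightarrow> nat) set) c. finite A \<and>
        (\<forall>z. p z = (\<Sum>\<alpha>\<in>A. c \<alpha> * (\<Prod>i\<in>UNIV. (z $ i) ^ \<alpha> i))))"

text \<open>
  The derivative in the time variable is a complex derivative, the map
  \<open>h \<mapsto> h F(X\<^sub>t(z))\<close> being complex-linear. A flow in this sense is defined for all complex
  times, so a holomorphic vector field is complete iff it has such a flow. The flow is then
  unique, by uniqueness of solutions of initial value problems.
\<close>

definition complex_time_flow ::
    "(complex^'n \<Rightarrow> complex^'n) \<Rightarrow> (complex \<Rightarrow> complex^'n \<Rightarrow> complex^'n) \<Rightarrow> bool" where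
  "complex_time_flow F X \<longleftrightarrow>
     (\<forall>z. X 0 z = z) \<and>
     (\<forall>z t. ((\<lambda>s. X s z) has_derivative (\<lambda>h. h *s F (X t z))) (at t))"

definition lyapunov_stable_origin :: "(complex \<Rightarrow> complex^'n \<Rightarrow> complex^'n) \<Rightarrow> bool" where
  "lyapunov_stable_origin X \<longleftrightarrow>
     (\<forall>r>0. \<exists>\<delta>>0. \<forall>z. norm z < \<delta> \<longrightarrow> (\<forall>t\<ge>0. norm (X (complex_of_real t) z) < r))"

definition globally_attracting_origin ::
    "(complex^'n \<Rightarrow> complex^'n) \<Rightarrow> (complex \<Rightarrow> complex^'n \<Rightarrow> complex^'n) \<Rightarrow> bool" where
  "globally_attracting_origin F X \<longleftrightarrow>
     F 0 = 0 \<and> lyapunov_stable_origin X \<and>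
     (\<forall>z. ((\<lambda>t. X (complex_of_real t) z) \<longlongrightarrow> 0) at_top)"

definition domain_Cn :: "(complex^'n) set \<Rightarrow> bool" where
  "domain_Cn \<Omega> \<longleftrightarrow> open \<Omega> \<and> connected \<Omega>"

definition runge_domain :: "(complex^'n) set \<Rightarrow> bool" where
  "runge_domain \<Omega> \<longleftrightarrow> domain_Cn \<Omega> \<and>
     (\<forall>f. holomorphic_fun_on f \<Omega> \<longrightarrow>
        (\<forall>K \<epsilon>. compact K \<longrightarrow> K \<subseteq> \<Omega> \<longrightarrow> \<epsilon> > 0 \<longrightarrow>
           (\<exists>p. polynomial_fun p \<and> (\<forall>z\<in>K. norm (f z - p z) < \<epsilon>))))"

end

theory Submission
  imports Defs
begin

text \<open>
  Let \<open>f\<close> be holomorphic on \<open>\<Omega>\<close> and \<open>K \<subseteq> \<Omega>\<close> compact, and let \<open>P(K)\<close> be the uniform closure of the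
  polynomials on \<open>K\<close>. Consider the functions \<open>f \<circ> X\<^sub>t\<close> on \<open>K\<close>, which are defined for all real \<open>t \<ge> 0\<close>
  because \<open>\<Omega>\<close> is invariant.

  For large \<open>t\<close> the map \<open>X\<^sub>t\<close> carries \<open>K\<close> into a ball around the origin on which \<open>f\<close> is a uniform
  limit of polynomials, and \<open>X\<^sub>t\<close> is entire, so \<open>f \<circ> X\<^sub>t \<in> P(K)\<close>. For \<open>z \<in> K\<close> the function
  \<open>t \<mapsto> f (X\<^sub>t z)\<close> extends holomorphically, with a uniform bound, to complex discs of a fixed radius \<open>r\<close>
  around the points of \<open>[0, T]\<close>. If \<open>f \<circ> X\<^sub>s \<in> P(K)\<close> for all real \<open>s > \<tau>\<close>, then the Taylor
  coefficients at \<open>\<tau>\<close> belong to \<open>P(K)\<close>, being uniform limits of expressions in the values at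
  \<open>s > \<tau>\<close> and the coefficients of lower order (lemma \<open>poly_approximable_on_taylor_coeff\<close>), and so does \<open>f \<circ> X\<^sub>t\<close> for \<open>|t - \<tau>| < r\<close> (lemma
  \<open>poly_approximable_on_taylor_sum\<close>). Finitely many steps backwards in time lead to \<open>t = 0\<close>, that is,
  to \<open>f \<in> P(K)\<close> (lemma \<open>poly_approximable_on_invariant_domain\<close>).

  The same two lemmas on holomorphic families give the facts about several variables that are used:
  holomorphic functions are limits of polynomials on polydiscs, and the Lie derivative of an entire
  function is entire. The Taylor coefficients in \<open>t\<close> of \<open>X\<^sub>t z\<close> are iterated Lie derivatives of the
  coordinate functions at \<open>z\<close>. This yields the uniqueness of solutions, hence the group law of the
  flow, and, by convergence of the Taylor series for short times and composition, that each \<open>X\<^sub>t\<close> is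
  entire.
\<close>

section \<open>Polynomials and their uniform limits\<close>

lemma polynomial_fun_const: "polynomial_fun (\<lambda>z. k)"
  unfolding polynomial_fun_def
  by (rule exI[of _ "{\<lambda>_. 0}"], rule exI[of _ "\<lambda>_. k"]) simp

lemma polynomial_fun_coord: "polynomial_fun (\<lambda>z :: complex^'n. z $ i)"
proof -
  have "(\<Prod>j\<in>UNIV. (z $ j) ^ (if j = i then 1 else 0)) = z $ i" for z :: "complex^'n"
  proof -
    have "(\<Prod>j\<in>UNIV. (z $ j) ^ (if j = i then 1 else 0)) = (\<Prod>j\<in>UNIV. if j = i then z $ j else 1)"
      by (rule prod.cong) auto
    then show ?thesis by simp
  qed
  then show ?thesis
    unfolding polynomial_fun_def
    by (intro exI[of _ "{\<lambda>j. if j = i then 1 else 0}"] exI[of _ "\<lambda>_. 1"]) simp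
qed

lemma polynomial_fun_add:
  assumes "polynomial_fun p" "polynomial_fun q"
  shows "polynomial_fun (\<lambda>z. p z + q z)"
proof -
  obtain A c where A: "finite A" "\<And>z. p z = (\<Sum>\<alpha>\<in>A. c \<alpha> * (\<Prod>i\<in>UNIV. (z $ i) ^ \<alpha> i))"
    using assms(1) unfolding polynomial_fun_def by blast
  obtain B d where B: "finite B" "\<And>z. q z = (\<Sum>\<alpha>\<in>B. d \<alpha> * (\<Prod>i\<in>UNIV. (z $ i) ^ \<alpha> i))"
    using assms(2) unfolding polynomial_fun_def by blast
  let ?c = "\<lambda>\<alpha>. if \<alpha> \<in> A then c \<alpha> else 0" and ?d = "\<lambda>\<alpha>. if \<alpha> \<in> B then d \<alpha> else 0"
  have "p z + q z = (\<Sum>\<alpha>\<in>A \<union> B. (?c \<alpha> + ?d \<alpha>) * (\<Prod>i\<in>UNIV. (z $ i) ^ \<alpha> i))" for z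
  proof -
    have "p z = (\<Sum>\<alpha>\<in>A \<union> B. ?c \<alpha> * (\<Prod>i\<in>UNIV. (z $ i) ^ \<alpha> i))"
      unfolding A(2) by (rule sum.mono_neutral_cong_left) (use A(1) B(1) in auto)
    moreover have "q z = (\<Sum>\<alpha>\<in>A \<union> B. ?d \<alpha> * (\<Prod>i\<in>UNIV. (z $ i) ^ \<alpha> i))"
      unfolding B(2) by (rule sum.mono_neutral_cong_left) (use A(1) B(1) in auto)
    ultimately show ?thesis by (simp add: sum.distrib distrib_right)
  qed
  then show ?thesis
    unfolding polynomial_fun_def using A(1) B(1)
    by (intro exI[of _ "A \<union> B"] exI[of _ "\<lambda>\<alpha>. ?c \<alpha> + ?d \<alpha>"]) simp
qed

lemma polynomial_fun_sum:
  assumes "finite I" "\<And>i. i \<in> I \<Longrightarrow> polynomial_fun (p i)"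
  shows "polynomial_fun (\<lambda>z. \<Sum>i\<in>I. p i z)"
  using assms by (induction I rule: finite_induct) (auto intro: polynomial_fun_const polynomial_fun_add)

lemma polynomial_fun_mult_monomial:
  assumes "polynomial_fun p"
  shows "polynomial_fun (\<lambda>z. p z * (k * (\<Prod>i\<in>UNIV. (z $ i) ^ \<beta> i)))"
proof -
  obtain A c where A: "finite A" "\<And>z. p z = (\<Sum>\<alpha>\<in>A. c \<alpha> * (\<Prod>i\<in>UNIV. (z $ i) ^ \<alpha> i))"
    using assms unfolding polynomial_fun_def by blast
  let ?s = "\<lambda>\<alpha> i. \<alpha> i + \<beta> i :: nat"
  have inj: "inj_on ?s A"
    by (auto simp: inj_on_def fun_eq_iff)
  have "p z * (k * (\<Prod>i\<in>UNIV. (z $ i) ^ \<beta> i)) =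
      (\<Sum>\<gamma>\<in>?s ` A. (c (\<lambda>i. \<gamma> i - \<beta> i) * k) * (\<Prod>i\<in>UNIV. (z $ i) ^ \<gamma> i))" for z
    unfolding A(2) sum.reindex[OF inj]
    by (simp add: sum_distrib_left sum_distrib_right power_add prod.distrib mult_ac)
  then show ?thesis
    unfolding polynomial_fun_def using A(1)
    by (intro exI[of _ "?s ` A"] exI[of _ "\<lambda>\<gamma>. c (\<lambda>i. \<gamma> i - \<beta> i) * k"]) simp
qed

lemma polynomial_fun_mult:
  assumes "polynomial_fun p" "polynomial_fun q"
  shows "polynomial_fun (\<lambda>z. p z * q z)"
proof -
  obtain B d where B: "finite B" "\<And>z. q z = (\<Sum>\<alpha>\<in>B. d \<alpha> * (\<Prod>i\<in>UNIV. (z $ i) ^ \<alpha> i))"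
    using assms(2) unfolding polynomial_fun_def by blast
  show ?thesis
    unfolding B(2) sum_distrib_left
    by (intro polynomial_fun_sum polynomial_fun_mult_monomial assms B)
qed

lemma continuous_on_polynomial_fun:
  assumes "polynomial_fun p"
  shows "continuous_on S p"
proof -
  obtain A c where A: "finite A" "\<And>z. p z = (\<Sum>\<alpha>\<in>A. c \<alpha> * (\<Prod>i\<in>UNIV. (z $ i) ^ \<alpha> i))"
    using assms unfolding polynomial_fun_def by blast
  have "continuous_on S (\<lambda>z. \<Sum>\<alpha>\<in>A. c \<alpha> * (\<Prod>i\<in>UNIV. (z $ i) ^ \<alpha> i))"
    by (intro continuous_intros)
  then show ?thesis using A(2) by (simp add: fun_eq_iff cong: continuous_on_cong)
qed

text \<open>
  Membership of \<open>g\<close> in the closure of the polynomials for uniform convergence on \<open>K\<close>. On a compact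
  set this is a closed algebra, stable under composition.
\<close>

definition poly_approximable_on :: "(complex^'n) set \<Rightarrow> (complex^'n \<Rightarrow> complex) \<Rightarrow> bool" where
  "poly_approximable_on K g \<longleftrightarrow>
     (\<forall>\<epsilon>>0. \<exists>p. polynomial_fun p \<and> (\<forall>z\<in>K. norm (g z - p z) < \<epsilon>))"

lemma poly_approximable_onE:
  assumes "poly_approximable_on K g" "\<epsilon> > 0"
  obtains p where "polynomial_fun p" "\<And>z. z \<in> K \<Longrightarrow> norm (g z - p z) < \<epsilon>"
  using assms unfolding poly_approximable_on_def by blast

lemma polynomial_fun_imp_poly_approximable_on: "polynomial_fun p \<Longrightarrow> poly_approximable_on K p"
  unfolding poly_approximable_on_def by (intro allI impI exI[of _ p]) simp

lemma poly_approximable_on_const: "poly_approximable_on K (\<lambda>z. k)"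
  by (intro polynomial_fun_imp_poly_approximable_on polynomial_fun_const)

lemma poly_approximable_on_coord: "poly_approximable_on K (\<lambda>z :: complex^'n. z $ i)"
  by (intro polynomial_fun_imp_poly_approximable_on polynomial_fun_coord)

lemma poly_approximable_on_subset:
  "poly_approximable_on L g \<Longrightarrow> K \<subseteq> L \<Longrightarrow> poly_approximable_on K g"
  unfolding poly_approximable_on_def by (meson subsetD)

lemma poly_approximable_on_closed:
  assumes "\<And>\<epsilon>. \<epsilon> > 0 \<Longrightarrow> \<exists>h. poly_approximable_on K h \<and> (\<forall>z\<in>K. norm (g z - h z) < \<epsilon>)"
  shows "poly_approximable_on K g"
  unfolding poly_approximable_on_def
proof (intro allI impI)
  fix \<epsilon> :: real assume "\<epsilon> > 0"
  then obtain h where h: "poly_approximable_on K h" "\<And>z. z \<in> K \<Longrightarrow> norm (g z - h z) < \<epsilon>/2"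
    using assms[of "\<epsilon>/2"] by auto
  obtain p where p: "polynomial_fun p" "\<And>z. z \<in> K \<Longrightarrow> norm (h z - p z) < \<epsilon>/2"
    using poly_approximable_onE[OF h(1), of "\<epsilon>/2"] \<open>\<epsilon> > 0\<close> by auto
  have "norm (g z - p z) < \<epsilon>" if "z \<in> K" for z
    using norm_triangle_ineq[of "g z - h z" "h z - p z"] h(2)[OF that] p(2)[OF that] by simp
  with p(1) show "\<exists>p. polynomial_fun p \<and> (\<forall>z\<in>K. norm (g z - p z) < \<epsilon>)" by blast
qed

lemma poly_approximable_on_add:
  assumes "poly_approximable_on K g" "poly_approximable_on K h"
  shows "poly_approximable_on K (\<lambda>z. g z + h z)"
  unfolding poly_approximable_on_def
proof (intro allI impI)
  fix \<epsilon> :: real assume "\<epsilon> > 0"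
  obtain p where p: "polynomial_fun p" "\<And>z. z \<in> K \<Longrightarrow> norm (g z - p z) < \<epsilon>/2"
    using poly_approximable_onE[OF assms(1), of "\<epsilon>/2"] \<open>\<epsilon> > 0\<close> by auto
  obtain q where q: "polynomial_fun q" "\<And>z. z \<in> K \<Longrightarrow> norm (h z - q z) < \<epsilon>/2"
    using poly_approximable_onE[OF assms(2), of "\<epsilon>/2"] \<open>\<epsilon> > 0\<close> by auto
  have "norm ((g z + h z) - (p z + q z)) < \<epsilon>" if "z \<in> K" for z
    using norm_triangle_ineq[of "g z - p z" "h z - q z"] p(2)[OF that] q(2)[OF that]
    by (simp add: algebra_simps)
  with polynomial_fun_add[OF p(1) q(1)]
  show "\<exists>p. polynomial_fun p \<and> (\<forall>z\<in>K. norm ((g z + h z) - p z) < \<epsilon>)" by blast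
qed

lemma poly_approximable_on_bounded:
  assumes "poly_approximable_on K g" "compact K"
  obtains M where "M > 0" "\<And>z. z \<in> K \<Longrightarrow> norm (g z) \<le> M"
proof -
  obtain p where p: "polynomial_fun p" "\<And>z. z \<in> K \<Longrightarrow> norm (g z - p z) < 1"
    using poly_approximable_onE[OF assms(1), of 1] by auto
  have "compact (p ` K)"
    using continuous_on_polynomial_fun[OF p(1)] assms(2) by (rule compact_continuous_image)
  then obtain M where M: "M > 0" "\<And>z. z \<in> K \<Longrightarrow> norm (p z) \<le> M"
    using compact_imp_bounded bounded_pos by (metis image_eqI)
  have "norm (g z) \<le> M + 1" if "z \<in> K" for z
    using norm_triangle_ineq[of "g z - p z" "p z"] p(2)[OF that] M(2)[OF that] by simp
  then show ?thesis using M(1) that[of "M + 1"] by simp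
qed

lemma poly_approximable_on_mult:
  assumes "poly_approximable_on K g" "poly_approximable_on K h" "compact K"
  shows "poly_approximable_on K (\<lambda>z. g z * h z)"
proof -
  obtain M where M: "M > 0" "\<And>z. z \<in> K \<Longrightarrow> norm (g z) \<le> M"
    using poly_approximable_on_bounded[OF assms(1,3)] by blast
  obtain N where N: "N > 0" "\<And>z. z \<in> K \<Longrightarrow> norm (h z) \<le> N"
    using poly_approximable_on_bounded[OF assms(2,3)] by blast
  show ?thesis
    unfolding poly_approximable_on_def
  proof (intro allI impI)
    fix \<epsilon> :: real assume "\<epsilon> > 0"
    obtain q where q: "polynomial_fun q" "\<And>z. z \<in> K \<Longrightarrow> norm (h z - q z) < min 1 (\<epsilon>/(2*M))"
      using poly_approximable_onE[OF assms(2), of "min 1 (\<epsilon>/(2*M))"] \<open>\<epsilon> > 0\<close> M(1) by auto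
    obtain p where p: "polynomial_fun p" "\<And>z. z \<in> K \<Longrightarrow> norm (g z - p z) < \<epsilon>/(2*(N+1))"
      using poly_approximable_onE[OF assms(1), of "\<epsilon>/(2*(N+1))"] \<open>\<epsilon> > 0\<close> N(1) by auto
    have "norm (g z * h z - p z * q z) < \<epsilon>" if z: "z \<in> K" for z
    proof -
      have nq: "norm (q z) \<le> N + 1"
        using norm_triangle_ineq[of "q z - h z" "h z"] q(2)[OF z] N(2)[OF z]
        by (simp add: norm_minus_commute)
      have "g z * h z - p z * q z = g z * (h z - q z) + (g z - p z) * q z"
        by (simp add: algebra_simps)
      also have "norm \<dots> \<le> norm (g z) * norm (h z - q z) + norm (g z - p z) * norm (q z)"
        by (metis norm_triangle_ineq norm_mult)
      also have "\<dots> \<le> M * norm (h z - q z) + norm (g z - p z) * (N + 1)"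
        using M(2)[OF z] nq by (intro add_mono mult_mono) (use M(1) in auto)
      also have "\<dots> < M * (\<epsilon>/(2*M)) + (\<epsilon>/(2*(N+1))) * (N + 1)"
        using q(2)[OF z] p(2)[OF z] M(1) N(1)
        by (intro add_strict_mono mult_strict_left_mono mult_strict_right_mono) auto
      also have "\<dots> = \<epsilon>" using M(1) N(1) by (simp add: field_simps)
      finally show ?thesis .
    qed
    with polynomial_fun_mult[OF p(1) q(1)]
    show "\<exists>p. polynomial_fun p \<and> (\<forall>z\<in>K. norm (g z * h z - p z) < \<epsilon>)" by blast
  qed
qed

lemma poly_approximable_on_diff:
  assumes "poly_approximable_on K g" "poly_approximable_on K h" "compact K"
  shows "poly_approximable_on K (\<lambda>z. g z - h z)"
  using poly_approximable_on_add[OF assms(1) poly_approximable_on_mult[OF poly_approximable_on_const[of _ "-1"] assms(2,3)]]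
  by simp

lemma poly_approximable_on_sum:
  assumes "finite I" "\<And>i. i \<in> I \<Longrightarrow> poly_approximable_on K (g i)"
  shows "poly_approximable_on K (\<lambda>z. \<Sum>i\<in>I. g i z)"
  using assms
  by (induction I rule: finite_induct) (auto intro: poly_approximable_on_const poly_approximable_on_add)

lemma poly_approximable_on_prod:
  assumes "finite I" "\<And>i. i \<in> I \<Longrightarrow> poly_approximable_on K (g i)" "compact K"
  shows "poly_approximable_on K (\<lambda>z. \<Prod>i\<in>I. g i z)"
  using assms
  by (induction I rule: finite_induct) (auto intro: poly_approximable_on_const poly_approximable_on_mult)

lemma poly_approximable_on_power:
  assumes "poly_approximable_on K g" "compact K"
  shows "poly_approximable_on K (\<lambda>z. g z ^ m)"
  using assms
  by (induction m) (auto intro: poly_approximable_on_const poly_approximable_on_mult)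

text \<open>
  Only the values of \<open>\<phi>\<close> on \<open>K\<close> have to lie in \<open>L\<close>: a polynomial close to \<open>G\<close> on \<open>L\<close> is composed
  exactly with \<open>\<phi>\<close>, and the algebra structure of the closure does the rest.
\<close>

lemma poly_approximable_on_compose:
  fixes \<phi> :: "complex^'n \<Rightarrow> complex^'n"
  assumes G: "poly_approximable_on L G" and \<phi>: "\<And>i. poly_approximable_on K (\<lambda>z. \<phi> z $ i)"
    and "compact K" "\<phi> ` K \<subseteq> L"
  shows "poly_approximable_on K (\<lambda>z. G (\<phi> z))"
proof (rule poly_approximable_on_closed)
  fix \<epsilon> :: real assume "\<epsilon> > 0"
  then obtain p where p: "polynomial_fun p" "\<And>z. z \<in> L \<Longrightarrow> norm (G z - p z) < \<epsilon>"
    using poly_approximable_onE[OF G] by blast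
  obtain A c where A: "finite A" "\<And>z. p z = (\<Sum>\<alpha>\<in>A. c \<alpha> * (\<Prod>i\<in>UNIV. (z $ i) ^ \<alpha> i))"
    using p(1) unfolding polynomial_fun_def by blast
  have "poly_approximable_on K (\<lambda>z. p (\<phi> z))"
    unfolding A(2)
    by (intro poly_approximable_on_sum poly_approximable_on_mult poly_approximable_on_const
        poly_approximable_on_prod poly_approximable_on_power \<phi> A(1) \<open>compact K\<close>) simp
  moreover have "\<forall>z\<in>K. norm (G (\<phi> z) - p (\<phi> z)) < \<epsilon>"
    using p(2) assms(4) by blast
  ultimately show "\<exists>h. poly_approximable_on K h \<and> (\<forall>z\<in>K. norm (G (\<phi> z) - h z) < \<epsilon>)"
    by blast
qed

lemma continuous_on_poly_approximable_on:
  assumes "poly_approximable_on K g"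
  shows "continuous_on K g"
proof -
  have "\<exists>p. polynomial_fun p \<and> (\<forall>z\<in>K. norm (g z - p z) < 1 / Suc n)" for n
    using poly_approximable_onE[OF assms, of "1 / Suc n"] by (metis of_nat_0_less_iff zero_less_Suc zero_less_divide_1_iff)
  then obtain p where p: "\<And>n. polynomial_fun (p n)"
    "\<And>n z. z \<in> K \<Longrightarrow> norm (g z - p n z) < 1 / Suc n"
    by metis
  have "uniform_limit K p g sequentially"
  proof (rule uniform_limitI)
    fix e :: real assume "e > 0"
    then have "\<forall>\<^sub>F n in sequentially. 1 / Suc n < e"
      using order_tendstoD(2)[OF LIMSEQ_inverse_real_of_nat, of e] by (simp add: inverse_eq_divide)
    then show "\<forall>\<^sub>F n in sequentially. \<forall>z\<in>K. dist (p n z) (g z) < e"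
      by eventually_elim (use p(2) in \<open>force simp: dist_norm norm_minus_commute intro: less_trans\<close>)
  qed
  then show ?thesis
    by (rule uniform_limit_theorem[rotated]) (auto intro!: always_eventually continuous_on_polynomial_fun p)
qed

section \<open>Holomorphic families of functions\<close>

text \<open>
  The Taylor remainder of order \<open>k\<close>, bounded uniformly over all functions with the same bound \<open>M\<close>.
\<close>

lemma taylor_remainder_le:
  assumes "f holomorphic_on ball a R" "\<And>w. w \<in> ball a R \<Longrightarrow> norm (f w) \<le> M"
    and r: "0 < r" "r < R" and w: "norm w < r"
  shows "norm (f (a + w) - (\<Sum>j<k. (deriv ^^ j) f a / fact j * w ^ j))
    \<le> M * (norm w / r) ^ k / (1 - norm w / r)"
proof -
  let ?c = "\<lambda>j. (deriv ^^ j) f a / fact j" and ?q = "norm w / r"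
  have q: "0 \<le> ?q" "?q < 1" using r w by auto
  have c: "norm (?c j) \<le> M / r ^ j" for j
  proof -
    have "norm ((deriv ^^ j) f a) \<le> fact j * M / r ^ j"
    proof (rule Cauchy_inequality)
      show "f holomorphic_on ball a r"
        using assms(1) by (rule holomorphic_on_subset) (use r in auto)
      show "continuous_on (cball a r) f"
        using holomorphic_on_imp_continuous_on[OF assms(1)] by (rule continuous_on_subset) (use r in auto)
      show "norm (f x) \<le> M" if "norm (a - x) = r" for x
        using assms(2) that r by (simp add: dist_norm)
    qed (use r in auto)
    then show ?thesis by (simp add: norm_divide field_simps)
  qed
  have "(\<lambda>j. ?c j * w ^ j) sums f (a + w)"
    using holomorphic_power_series[OF assms(1), of "a + w"] r w by (simp add: dist_norm)
  then have "(\<lambda>j. ?c (j + k) * w ^ (j + k)) sums (f (a + w) - (\<Sum>j<k. ?c j * w ^ j))"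
    by (rule sums_split_initial_segment)
  moreover have "(\<lambda>j. M * ?q ^ k * ?q ^ j) sums (M * ?q ^ k * (1 / (1 - ?q)))"
    using q by (intro sums_mult geometric_sums) simp
  moreover have "norm (?c (j + k) * w ^ (j + k)) \<le> M * ?q ^ k * ?q ^ j" for j
  proof -
    have "norm (?c (j + k) * w ^ (j + k)) \<le> M / r ^ (j + k) * norm w ^ (j + k)"
      unfolding norm_mult norm_power by (intro mult_right_mono c) auto
    then show ?thesis by (simp add: power_divide power_add field_simps)
  qed
  ultimately have "norm (f (a + w) - (\<Sum>j<k. ?c j * w ^ j)) \<le> M * ?q ^ k * (1 / (1 - ?q))"
    by (rule norm_sums_le)
  then show ?thesis by simp
qed


text \<open>
  The Taylor coefficients at \<open>a\<close> are recovered, one after the other and uniformly in \<open>z\<close>, from the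
  values at points \<open>a + s\<close> with \<open>s > 0\<close> real and small. If these values are limits of polynomials, so
  are all the coefficients, and hence, by the lemma after this one, all the values on the disc. The
  pair of lemmas replaces the Hahn-Banach argument in which a measure on \<open>K\<close> annihilating the
  polynomials is integrated against \<open>h\<close>, giving a holomorphic function of \<open>t\<close> that vanishes on a
  segment.
\<close>

lemma poly_approximable_on_taylor_coeff:
  fixes h :: "complex^'n \<Rightarrow> complex \<Rightarrow> complex"
  assumes K: "compact K" and R: "R > 0"
    and hol: "\<And>z. z \<in> K \<Longrightarrow> h z holomorphic_on ball a R"
    and bd: "\<And>z t. z \<in> K \<Longrightarrow> t \<in> ball a R \<Longrightarrow> norm (h z t) \<le> M"
    and \<delta>: "\<delta> > 0"
    and ap: "\<And>s::real. 0 < s \<Longrightarrow> s < \<delta> \<Longrightarrow> poly_approximable_on K (\<lambda>z. h z (a + of_real s))"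
  shows "poly_approximable_on K (\<lambda>z. (deriv ^^ k) (h z) a / fact k)"
proof (induction k rule: less_induct)
  case (less k)
  let ?c = "\<lambda>j z. (deriv ^^ j) (h z) a / fact j"
  define N where "N = \<bar>M\<bar> + 1"
  define r where "r = R / 2"
  have N: "N > 0" and r: "0 < r" "r < R" using R by (auto simp: N_def r_def)
  show ?case
  proof (rule poly_approximable_on_closed)
    fix \<epsilon> :: real assume \<epsilon>: "\<epsilon> > 0"
    define s where "s = Min {\<delta>/2, r/2, \<epsilon> * r ^ Suc k / (4 * N)}"
    have s: "0 < s" "s \<le> \<delta>/2" "s \<le> r/2" "s \<le> \<epsilon> * r ^ Suc k / (4 * N)"
      using \<delta> r \<epsilon> N by (auto simp: s_def)
    \<comment> \<open>By the remainder estimate, \<open>g\<close> differs from the coefficient of order \<open>k\<close> by \<open>O(s)\<close>.\<close>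
    define g where "g z = (h z (a + of_real s) - (\<Sum>j<k. ?c j z * of_real s ^ j)) * (1 / of_real s ^ k)" for z
    have "poly_approximable_on K g"
      unfolding g_def
      by (intro poly_approximable_on_mult poly_approximable_on_diff poly_approximable_on_const
          poly_approximable_on_sum K ap less.IH) (use s \<delta> in auto)
    moreover have "norm (?c k z - g z) < \<epsilon>" if z: "z \<in> K" for z
    proof -
      have "norm (h z (a + of_real s) - (\<Sum>j<Suc k. ?c j z * of_real s ^ j))
          \<le> N * (norm (of_real s :: complex) / r) ^ Suc k / (1 - norm (of_real s :: complex) / r)"
      proof (rule taylor_remainder_le)
        show "h z holomorphic_on ball a R" by (rule hol[OF z])
        show "norm (h z w) \<le> N" if "w \<in> ball a R" for w
          using bd[OF z that] by (simp add: N_def)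
      qed (use r s in auto)
      also have "\<dots> = N * (s / r) ^ Suc k / (1 - s / r)"
        using s by simp
      also have "\<dots> \<le> N * (s / r) ^ Suc k / (1 / 2)"
        using s r N by (intro divide_left_mono mult_pos_pos) (auto simp: field_simps)
      finally have *: "norm (h z (a + of_real s) - (\<Sum>j<Suc k. ?c j z * of_real s ^ j))
          \<le> 2 * N * (s / r) ^ Suc k" by (simp add: mult_ac)
      have "?c k z - g z = - ((h z (a + of_real s) - (\<Sum>j<Suc k. ?c j z * of_real s ^ j)) / of_real s ^ k)"
        using s by (simp add: g_def field_simps)
      then have "norm (?c k z - g z) = norm (h z (a + of_real s) - (\<Sum>j<Suc k. ?c j z * of_real s ^ j)) / s ^ k"
        using s by (simp only: norm_minus_cancel norm_divide norm_power) simp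
      also have "\<dots> \<le> 2 * N * (s / r) ^ Suc k / s ^ k"
        using * s by (intro divide_right_mono) auto
      also have "\<dots> = 2 * N * s / r ^ Suc k"
        using s r by (simp add: power_divide field_simps)
      also have "\<dots> \<le> 2 * N * (\<epsilon> * r ^ Suc k / (4 * N)) / r ^ Suc k"
        using s(4) N r by (intro divide_right_mono mult_left_mono) auto
      also have "\<dots> = \<epsilon> / 2"
        using N r by (simp add: field_simps)
      finally show ?thesis using \<epsilon> by simp
    qed
    ultimately show "\<exists>g. poly_approximable_on K g \<and> (\<forall>z\<in>K. norm (?c k z - g z) < \<epsilon>)"
      by blast
  qed
qed

text \<open>
  The point \<open>\<tau> z\<close> of evaluation may depend on \<open>z\<close>; with \<open>\<tau>\<close> a coordinate function the lemma adds
  a variable, with \<open>\<tau>\<close> constant it moves along the parameter \<open>t\<close>.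
\<close>

lemma poly_approximable_on_taylor_sum:
  fixes h :: "complex^'n \<Rightarrow> complex \<Rightarrow> complex"
  assumes K: "compact K" and R: "0 \<le> R'" "R' < R"
    and hol: "\<And>z. z \<in> K \<Longrightarrow> h z holomorphic_on ball a R"
    and bd: "\<And>z t. z \<in> K \<Longrightarrow> t \<in> ball a R \<Longrightarrow> norm (h z t) \<le> M"
    and c: "\<And>k. poly_approximable_on K (\<lambda>z. (deriv ^^ k) (h z) a / fact k)"
    and \<tau>: "poly_approximable_on K \<tau>" "\<And>z. z \<in> K \<Longrightarrow> norm (\<tau> z - a) \<le> R'"
  shows "poly_approximable_on K (\<lambda>z. h z (\<tau> z))"
proof (rule poly_approximable_on_closed)
  fix \<epsilon> :: real assume \<epsilon>: "\<epsilon> > 0"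
  let ?c = "\<lambda>j z. (deriv ^^ j) (h z) a / fact j"
  define N where "N = \<bar>M\<bar> + 1"
  define r where "r = (R + R') / 2"
  define q where "q = R' / r"
  have N: "N > 0" and r: "0 < r" "r < R" "R' < r" using R by (auto simp: N_def r_def)
  have q: "0 \<le> q" "q < 1" using r R by (auto simp: q_def)
  have "(\<lambda>k. N * q ^ k / (1 - q)) \<longlonglongrightarrow> N * 0 / (1 - q)"
    using q by (intro tendsto_intros LIMSEQ_realpow_zero) auto
  then have "\<forall>\<^sub>F k in sequentially. N * q ^ k / (1 - q) < \<epsilon>"
    using \<epsilon> by (intro order_tendstoD(2)[of _ "0"]) auto
  then obtain k where k: "N * q ^ k / (1 - q) < \<epsilon>"
    by (auto simp: eventually_sequentially)
  define g where "g z = (\<Sum>j<k. ?c j z * (\<tau> z - a) ^ j)" for z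
  have "poly_approximable_on K g"
    unfolding g_def
    by (intro poly_approximable_on_mult poly_approximable_on_diff poly_approximable_on_const
        poly_approximable_on_sum poly_approximable_on_power K c \<tau>(1)) simp
  moreover have "norm (h z (\<tau> z) - g z) < \<epsilon>" if z: "z \<in> K" for z
  proof -
    let ?w = "\<tau> z - a"
    have w: "norm ?w / r \<le> q" using \<tau>(2)[OF z] r by (simp add: q_def divide_right_mono)
    have "norm (h z (a + ?w) - g z) \<le> N * (norm ?w / r) ^ k / (1 - norm ?w / r)"
      unfolding g_def
    proof (rule taylor_remainder_le)
      show "h z holomorphic_on ball a R" by (rule hol[OF z])
      show "norm (h z w) \<le> N" if "w \<in> ball a R" for w
        using bd[OF z that] by (simp add: N_def)
      show "norm ?w < r" using \<tau>(2)[OF z] r by simp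
    qed (use r in auto)
    also have "\<dots> \<le> N * q ^ k / (1 - q)"
      using w q N r by (intro frac_le mult_left_mono power_mono mult_nonneg_nonneg) auto
    finally show ?thesis using k by simp
  qed
  ultimately show "\<exists>g. poly_approximable_on K g \<and> (\<forall>z\<in>K. norm (h z (\<tau> z) - g z) < \<epsilon>)"
    by blast
qed

section \<open>Holomorphic functions along complex curves\<close>

lemma norm_vector_smult: "norm (c *s (v :: complex^'n)) = norm c * norm v"
  by (simp add: norm_vec_def norm_mult L2_set_right_distrib)

lemma bounded_linear_vector_smult_left: "bounded_linear (\<lambda>h. h *s (v :: complex^'n))"
  by (rule bounded_linear_intro[of _ "norm v"])
    (auto simp: vector_sadd_rdistrib norm_vector_smult vec_eq_iff mult.commute)

lemma norm_le_sum_components: "norm (z :: complex^'n) \<le> (\<Sum>i\<in>UNIV. norm (z $ i))"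
  unfolding norm_vec_def by (rule L2_set_le_sum) simp

lemma has_derivative_line: "((\<lambda>h. z + h *s (v :: complex^'n)) has_derivative (\<lambda>h. h *s v)) (at t)"
proof -
  have "((\<lambda>h. z + h *s v) has_derivative (\<lambda>h. 0 + h *s v)) (at t)"
    by (intro has_derivative_add has_derivative_const bounded_linear_imp_has_derivative
        bounded_linear_vector_smult_left)
  then show ?thesis by simp
qed

lemma has_field_derivative_along_curve:
  fixes f :: "complex^'n \<Rightarrow> complex"
  assumes "(f has_derivative D) (at (\<gamma> t))" "\<And>c w. D (c *s w) = c * D w"
    and "(\<gamma> has_derivative (\<lambda>h. h *s v)) (at t)"
  shows "((\<lambda>s. f (\<gamma> s)) has_field_derivative D v) (at t)"
proof -
  have "((\<lambda>s. f (\<gamma> s)) has_derivative (\<lambda>h. D (h *s v))) (at t)"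
    using has_derivative_compose[OF assms(3,1)] .
  then show ?thesis
    by (simp add: has_field_derivative_def assms(2) mult.commute[of _ "D v"])
qed

lemma holomorphic_fun_on_along_curve:
  fixes f :: "complex^'n \<Rightarrow> complex"
  assumes "holomorphic_fun_on f U" "open U" "open T"
    and "\<And>t. t \<in> T \<Longrightarrow> (\<gamma> has_derivative (\<lambda>h. h *s v t)) (at t)" "\<And>t. t \<in> T \<Longrightarrow> \<gamma> t \<in> U"
  shows "(\<lambda>s. f (\<gamma> s)) holomorphic_on T"
proof -
  have "\<exists>d. ((\<lambda>s. f (\<gamma> s)) has_field_derivative d) (at t)" if t: "t \<in> T" for t
  proof -
    have \<gamma>: "\<gamma> t \<in> U" using assms(5) t .
    obtain D where "(f has_derivative D) (at (\<gamma> t) within U)" "\<And>c w. D (c *s w) = c * D w"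
      using assms(1) \<gamma> unfolding holomorphic_fun_on_def by blast
    moreover have "at (\<gamma> t) within U = at (\<gamma> t)"
      using \<gamma> assms(2) by (rule at_within_open)
    ultimately show ?thesis
      using has_field_derivative_along_curve[of f D \<gamma> t "v t"] assms(4)[OF t] by auto
  qed
  then show ?thesis
    using assms(3) by (simp add: holomorphic_on_open)
qed

lemma continuous_on_holomorphic_fun_on:
  assumes "holomorphic_fun_on f S"
  shows "continuous_on S f"
  using assms unfolding holomorphic_fun_on_def
  by (metis continuous_on_eq_continuous_within has_derivative_continuous)

lemma holomorphic_fun_on_const: "holomorphic_fun_on (\<lambda>z. k) S"
  unfolding holomorphic_fun_on_def by (intro ballI exI[of _ "\<lambda>_. 0"]) simp

lemma holomorphic_fun_on_coord: "holomorphic_fun_on (\<lambda>z :: complex^'n. z $ i) S"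
  unfolding holomorphic_fun_on_def
  by (intro ballI exI[of _ "\<lambda>z. z $ i"])
    (auto intro: bounded_linear_imp_has_derivative)

lemma holomorphic_fun_on_add:
  assumes "holomorphic_fun_on f S" "holomorphic_fun_on g S"
  shows "holomorphic_fun_on (\<lambda>z. f z + g z) S"
  unfolding holomorphic_fun_on_def
proof
  fix z assume z: "z \<in> S"
  obtain D where D: "(f has_derivative D) (at z within S)" "\<And>c v. D (c *s v) = c * D v"
    using assms(1) z unfolding holomorphic_fun_on_def by blast
  obtain E where E: "(g has_derivative E) (at z within S)" "\<And>c v. E (c *s v) = c * E v"
    using assms(2) z unfolding holomorphic_fun_on_def by blast
  show "\<exists>D. ((\<lambda>z. f z + g z) has_derivative D) (at z within S) \<and> (\<forall>c v. D (c *s v) = c * D v)"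
    by (rule exI, rule conjI, rule has_derivative_add[OF D(1) E(1)])
      (simp add: D(2) E(2) algebra_simps)
qed

lemma holomorphic_fun_on_mult:
  assumes "holomorphic_fun_on f S" "holomorphic_fun_on g S"
  shows "holomorphic_fun_on (\<lambda>z. f z * g z) S"
  unfolding holomorphic_fun_on_def
proof
  fix z assume z: "z \<in> S"
  obtain D where D: "(f has_derivative D) (at z within S)" "\<And>c v. D (c *s v) = c * D v"
    using assms(1) z unfolding holomorphic_fun_on_def by blast
  obtain E where E: "(g has_derivative E) (at z within S)" "\<And>c v. E (c *s v) = c * E v"
    using assms(2) z unfolding holomorphic_fun_on_def by blast
  show "\<exists>D. ((\<lambda>z. f z * g z) has_derivative D) (at z within S) \<and> (\<forall>c v. D (c *s v) = c * D v)"
    by (rule exI, rule conjI, rule has_derivative_mult[OF D(1) E(1)])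
      (simp add: D(2) E(2) algebra_simps)
qed

lemma holomorphic_fun_on_polynomial_fun:
  assumes "polynomial_fun p"
  shows "holomorphic_fun_on p S"
proof -
  obtain A c where A: "finite A" "\<And>z. p z = (\<Sum>\<alpha>\<in>A. c \<alpha> * (\<Prod>i\<in>UNIV. (z $ i) ^ \<alpha> i))"
    using assms unfolding polynomial_fun_def by blast
  have pow: "holomorphic_fun_on (\<lambda>z. (z $ i) ^ m) S" for i m
    by (induction m) (auto intro: holomorphic_fun_on_const holomorphic_fun_on_mult holomorphic_fun_on_coord)
  have mon: "holomorphic_fun_on (\<lambda>z. \<Prod>i\<in>I. (z $ i) ^ \<alpha> i) S" if "finite I" for I \<alpha>
    using that by (induction I rule: finite_induct)
      (auto intro: holomorphic_fun_on_const holomorphic_fun_on_mult pow)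
  have "holomorphic_fun_on (\<lambda>z. \<Sum>\<alpha>\<in>A. c \<alpha> * (\<Prod>i\<in>UNIV. (z $ i) ^ \<alpha> i)) S"
    using A(1) by (induction A rule: finite_induct)
      (auto intro!: holomorphic_fun_on_const holomorphic_fun_on_add holomorphic_fun_on_mult mon)
  moreover have "p = (\<lambda>z. \<Sum>\<alpha>\<in>A. c \<alpha> * (\<Prod>i\<in>UNIV. (z $ i) ^ \<alpha> i))"
    using A(2) by (rule ext)
  ultimately show ?thesis by simp
qed

section \<open>Polynomial approximation on polydiscs\<close>

text \<open>The closed polydisc of polyradius \<open>(r, \<dots>, r)\<close> around the origin.\<close>

definition polydisc :: "real \<Rightarrow> (complex^'n) set" where
  "polydisc r = {z. \<forall>i. norm (z $ i) \<le> r}"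

lemma compact_polydisc: "compact (polydisc r :: (complex^'n) set)"
proof -
  have "norm z \<le> (\<Sum>i\<in>(UNIV::'n set). r)" if "z \<in> polydisc r" for z :: "complex^'n"
    using norm_le_sum_components[of z] that unfolding polydisc_def
    by (smt (verit) mem_Collect_eq sum_mono)
  then have "bounded (polydisc r :: (complex^'n) set)"
    unfolding bounded_iff by blast
  moreover have "closed (polydisc r :: (complex^'n) set)"
    unfolding polydisc_def by (intro closed_Collect_all closed_Collect_le continuous_intros)
  ultimately show ?thesis by (simp add: compact_eq_bounded_closed)
qed

lemma cball_subset_polydisc: "cball 0 r \<subseteq> polydisc r"
  unfolding polydisc_def using Finite_Cartesian_Product.norm_nth_le order_trans by fastforce

text \<open>
  The variables are set free one at a time, in place of a Taylor expansion in several variables: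
  when \<open>f\<close> with the variables in \<open>S\<close> free and the others frozen at any \<open>b\<close> is a limit of polynomials,
  the one-variable expansion in the coordinate \<open>j\<close> frees \<open>j\<close> as well.
\<close>

lemma poly_approximable_on_polydisc:
  fixes f :: "complex^'n \<Rightarrow> complex"
  assumes f: "holomorphic_fun_on f U" "open U" and U: "polydisc R \<subseteq> U" and r: "0 < r" "r < R"
  shows "poly_approximable_on (polydisc r) f"
proof -
  let ?P = "polydisc r :: (complex^'n) set"
  have "compact (f ` polydisc R)"
    using continuous_on_subset[OF continuous_on_holomorphic_fun_on[OF f(1)] U] compact_polydisc
    by (rule compact_continuous_image)
  then obtain M where M: "\<And>z. z \<in> polydisc R \<Longrightarrow> norm (f z) \<le> M"
    using compact_imp_bounded bounded_pos by (metis image_eqI)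
  have main: "\<forall>b\<in>?P. poly_approximable_on ?P (\<lambda>z. f (\<chi> i. if i \<in> S then z $ i else b $ i))"
    if "finite S" for S :: "'n set"
    using that
  proof (induction S rule: finite_induct)
    case empty
    then show ?case by (simp add: poly_approximable_on_const)
  next
    case (insert j S)
    show ?case
    proof
      fix b :: "complex^'n" assume b: "b \<in> ?P"
      define \<gamma> where "\<gamma> z t = (\<chi> i. if i = j then t else if i \<in> S then z $ i else b $ i)" for z :: "complex^'n" and t
      have \<gamma>_line: "\<gamma> z = (\<lambda>t. \<gamma> z 0 + t *s axis j 1)" for z
        by (auto simp: \<gamma>_def vec_eq_iff axis_def)
      have \<gamma>_deriv: "(\<gamma> z has_derivative (\<lambda>h. h *s axis j 1)) (at t)" for z t
        by (subst \<gamma>_line) (rule has_derivative_line)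
      have \<gamma>_in: "\<gamma> z t \<in> polydisc R" if "z \<in> ?P" "t \<in> ball 0 R" for z t
        using that b r by (fastforce simp: \<gamma>_def polydisc_def intro: order_trans less_imp_le)
      have hol: "(\<lambda>t. f (\<gamma> z t)) holomorphic_on ball 0 R" if "z \<in> ?P" for z
        using \<gamma>_in[OF that] U by (intro holomorphic_fun_on_along_curve[OF f _ \<gamma>_deriv]) auto
      have bd: "norm (f (\<gamma> z t)) \<le> M" if "z \<in> ?P" "t \<in> ball 0 R" for z t
        using M \<gamma>_in that by blast
      show "poly_approximable_on ?P (\<lambda>z. f (\<chi> i. if i \<in> insert j S then z $ i else b $ i))"
      proof -
        have "poly_approximable_on ?P (\<lambda>z. f (\<gamma> z (0 + of_real s)))" if "0 < s" "s < r" for s :: real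
        proof -
          define b' where "b' = (\<chi> i. if i = j then complex_of_real s else b $ i)"
          have "b' \<in> ?P" using b that by (auto simp: b'_def polydisc_def)
          moreover have "\<gamma> z (0 + of_real s) = (\<chi> i. if i \<in> S then z $ i else b' $ i)" for z
            using insert.hyps by (auto simp: \<gamma>_def b'_def vec_eq_iff)
          ultimately show ?thesis using insert.IH by simp
        qed
        then have "poly_approximable_on ?P (\<lambda>z. (deriv ^^ k) (\<lambda>t. f (\<gamma> z t)) 0 / fact k)" for k
          using r by (intro poly_approximable_on_taylor_coeff[OF compact_polydisc _ hol bd, of r]) auto
        then have "poly_approximable_on ?P (\<lambda>z. f (\<gamma> z (z $ j)))"
          by (intro poly_approximable_on_taylor_sum[OF compact_polydisc less_imp_le[OF r(1)] r(2) hol bd _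
              poly_approximable_on_coord])
            (auto simp: polydisc_def)
        moreover have "\<gamma> z (z $ j) = (\<chi> i. if i \<in> insert j S then z $ i else b $ i)" for z
          by (auto simp: \<gamma>_def vec_eq_iff)
        ultimately show ?thesis by simp
      qed
    qed
  qed
  have "0 \<in> ?P" using r by (simp add: polydisc_def)
  then show ?thesis using bspec[OF main[OF finite_class.finite_UNIV], of 0] by simp
qed

section \<open>Entire functions and entire curves\<close>

text \<open>
  Entire functions, encoded as the functions on \<open>\<complex>\<^sup>n\<close> that are limits of polynomials, uniformly on
  bounded sets. In this form derivatives along a vector field stay in the class.
\<close>

definition poly_entire :: "(complex^'n \<Rightarrow> complex) \<Rightarrow> bool" where
  "poly_entire G \<longleftrightarrow> (\<forall>R. poly_approximable_on (cball 0 R) G)"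

lemma holomorphic_imp_poly_entire:
  assumes "holomorphic_fun_on f UNIV"
  shows "poly_entire f"
  unfolding poly_entire_def
proof
  fix R :: real
  let ?r = "max R 1"
  have "poly_approximable_on (polydisc ?r) f"
    by (rule poly_approximable_on_polydisc[OF assms, of "?r + 1"]) auto
  moreover have "cball 0 R \<subseteq> (polydisc ?r :: (complex^'a) set)"
    by (rule order_trans[OF _ cball_subset_polydisc]) (rule subset_cball, simp)
  ultimately show "poly_approximable_on (cball 0 R) f"
    by (rule poly_approximable_on_subset)
qed


lemma poly_entire_approximable_on:
  assumes "poly_entire G" "bounded K"
  shows "poly_approximable_on K G"
proof -
  obtain R where "K \<subseteq> cball 0 R"
    using assms(2) by (auto simp: bounded_iff subset_iff)
  then show ?thesis
    using assms(1) unfolding poly_entire_def by (blast intro: poly_approximable_on_subset)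
qed

lemma poly_entire_bounded:
  assumes "poly_entire G" "bounded K"
  obtains M where "M > 0" "\<And>z. z \<in> K \<Longrightarrow> norm (G z) \<le> M"
proof -
  have "poly_approximable_on (closure K) G" "compact (closure K)"
    using assms by (auto intro: poly_entire_approximable_on simp: compact_closure)
  from poly_approximable_on_bounded[OF this]
  obtain M where "M > 0" "\<And>z. z \<in> closure K \<Longrightarrow> norm (G z) \<le> M"
    by blast
  then show ?thesis
    by (intro that[of M]) (use closure_subset in auto)
qed

lemma poly_entire_polynomial_sequence:
  assumes "poly_entire G"
  obtains p where "\<And>n. polynomial_fun (p n)"
    "\<And>K. bounded K \<Longrightarrow> uniform_limit K p G sequentially"
proof -
  have "\<exists>p. polynomial_fun p \<and> (\<forall>z\<in>cball 0 (real n). norm (G z - p z) < 1 / Suc n)" for n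
    using assms poly_approximable_onE[of "cball 0 (real n)" G "1 / Suc n"]
    unfolding poly_entire_def by (metis of_nat_0_less_iff zero_less_Suc zero_less_divide_1_iff)
  then obtain p where p: "\<And>n. polynomial_fun (p n)"
    "\<And>n z. z \<in> cball 0 (real n) \<Longrightarrow> norm (G z - p n z) < 1 / Suc n"
    by metis
  have "uniform_limit K p G sequentially" if K: "bounded K" for K
  proof (rule uniform_limitI)
    fix e :: real assume "e > 0"
    obtain R where R: "K \<subseteq> cball 0 R"
      using K by (auto simp: bounded_iff subset_iff)
    have "\<forall>\<^sub>F n in sequentially. 1 / Suc n < e"
      using order_tendstoD(2)[OF LIMSEQ_inverse_real_of_nat, of e] \<open>e > 0\<close>
      by (simp add: inverse_eq_divide)
    moreover have "\<forall>\<^sub>F n in sequentially. R \<le> real n"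
      using filterlim_real_sequentially by (simp add: filterlim_at_top)
    ultimately show "\<forall>\<^sub>F n in sequentially. \<forall>z\<in>K. dist (p n z) (G z) < e"
    proof eventually_elim
      case (elim n)
      have "dist (p n z) (G z) < e" if "z \<in> K" for z
      proof -
        have "z \<in> cball 0 (real n)" using R that elim(2) by auto
        from p(2)[OF this] elim(1) show ?thesis
          by (simp add: dist_norm norm_minus_commute)
      qed
      then show ?case by blast
    qed
  qed
  with p(1) show ?thesis using that by blast
qed

text \<open>
  An entire curve \<open>\<gamma>\<close> in \<open>\<complex>\<^sup>n\<close> with velocity \<open>v\<close>; the velocity is a complex derivative. A solution of
  the differential equation of a field \<open>F\<close> is an entire curve \<open>y\<close> with velocity \<open>\<lambda>t. F (y t)\<close>.
\<close>

definition entire_curve :: "(complex \<Rightarrow> complex^'n) \<Rightarrow> (complex \<Rightarrow> complex^'n) \<Rightarrow> bool" where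
  "entire_curve \<gamma> v \<longleftrightarrow> (\<forall>t. (\<gamma> has_derivative (\<lambda>h. h *s v t)) (at t))"

lemma entire_curve_continuous_on: "entire_curve \<gamma> v \<Longrightarrow> continuous_on S \<gamma>"
  unfolding entire_curve_def
  by (meson continuous_at_imp_continuous_on has_derivative_continuous)

lemma entire_curve_line: "entire_curve (\<lambda>h. z + h *s v) (\<lambda>_. v)"
  by (simp add: entire_curve_def has_derivative_line)

lemma entire_curve_shift:
  assumes "entire_curve \<gamma> v"
  shows "entire_curve (\<lambda>s. \<gamma> (a + s)) (\<lambda>s. v (a + s))"
  unfolding entire_curve_def
proof
  fix t
  have "((\<lambda>s. a + s) has_derivative (\<lambda>h. h)) (at t)"
    by (auto intro!: derivative_eq_intros)
  moreover have "(\<gamma> has_derivative (\<lambda>h. h *s v (a + t))) (at (a + t))"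
    using assms by (simp add: entire_curve_def)
  ultimately show "((\<lambda>s. \<gamma> (a + s)) has_derivative (\<lambda>h. h *s v (a + t))) (at t)"
    by (rule has_derivative_compose)
qed

lemma uniform_limit_along_entire_curve:
  assumes "\<And>K. bounded K \<Longrightarrow> uniform_limit K p G sequentially" "entire_curve \<gamma> v"
  shows "uniform_limit (cball t r) (\<lambda>n s. p n (\<gamma> s)) (\<lambda>s. G (\<gamma> s)) sequentially"
proof -
  have "bounded (\<gamma> ` cball t r)"
    by (intro compact_imp_bounded compact_continuous_image entire_curve_continuous_on[OF assms(2)]) simp
  from assms(1)[OF this] show ?thesis
    unfolding uniform_limit_iff by simp
qed

lemma poly_entire_along_entire_curve:
  assumes G: "poly_entire G" and \<gamma>: "entire_curve \<gamma> v"
  shows "(\<lambda>s. G (\<gamma> s)) holomorphic_on UNIV"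
proof -
  obtain p where p: "\<And>n. polynomial_fun (p n)" "\<And>K. bounded K \<Longrightarrow> uniform_limit K p G sequentially"
    using poly_entire_polynomial_sequence[OF G] by metis
  show ?thesis
  proof (rule holomorphic_uniform_sequence)
    show "(\<lambda>s. p n (\<gamma> s)) holomorphic_on UNIV" for n
      using \<gamma> by (intro holomorphic_fun_on_along_curve[OF holomorphic_fun_on_polynomial_fun[OF p(1)], of UNIV])
        (auto simp: entire_curve_def)
    show "\<exists>d>0. cball t d \<subseteq> UNIV \<and>
        uniform_limit (cball t d) (\<lambda>n s. p n (\<gamma> s)) (\<lambda>s. G (\<gamma> s)) sequentially" for t
      using uniform_limit_along_entire_curve[OF p(2) \<gamma>, of t 1] by (intro exI[of _ 1]) simp
  qed simp
qed

text \<open>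
  The chain rule in the form needed: the derivative of \<open>G\<close> along a curve depends only on position and
  velocity. For polynomials this is the usual chain rule, and derivatives pass to uniform limits.
\<close>

lemma deriv_poly_entire_along_entire_curves:
  assumes G: "poly_entire G" and \<gamma>: "entire_curve \<gamma> v" and \<eta>: "entire_curve \<eta> w"
    and eq: "\<gamma> s = \<eta> t" "v s = w t"
  shows "deriv (\<lambda>s. G (\<gamma> s)) s = deriv (\<lambda>t. G (\<eta> t)) t"
proof -
  obtain p where p: "\<And>n. polynomial_fun (p n)" "\<And>K. bounded K \<Longrightarrow> uniform_limit K p G sequentially"
    using poly_entire_polynomial_sequence[OF G] by metis
  have lim: "(\<lambda>n. deriv (\<lambda>s. p n (\<gamma> s)) t) \<longlonglongrightarrow> deriv (\<lambda>s. G (\<gamma> s)) t"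
    if \<gamma>: "entire_curve \<gamma> v" for \<gamma> v t
  proof -
    have "uniform_limit (ball t 1) (\<lambda>n s. p n (\<gamma> s)) (\<lambda>s. G (\<gamma> s)) sequentially"
      using uniform_limit_along_entire_curve[OF p(2) \<gamma>, of t 1] ball_subset_cball
      by (rule uniform_limit_on_subset)
    moreover have "(\<lambda>s. p n (\<gamma> s)) holomorphic_on ball t 1" for n
      using \<gamma> by (intro holomorphic_fun_on_along_curve[OF holomorphic_fun_on_polynomial_fun[OF p(1)], of UNIV])
        (auto simp: entire_curve_def)
    ultimately show ?thesis
      using higher_deriv_complex_uniform_limit[where A = "ball t 1" and F = sequentially and z = t and m = 1
          and f = "\<lambda>n s. p n (\<gamma> s)"] by simp
  qed
  have "deriv (\<lambda>s. p n (\<gamma> s)) s = deriv (\<lambda>t. p n (\<eta> t)) t" for n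
  proof -
    obtain D where D: "(p n has_derivative D) (at (\<gamma> s))" "\<And>c v. D (c *s v) = c * D v"
      using holomorphic_fun_on_polynomial_fun[OF p(1)[of n], of UNIV] unfolding holomorphic_fun_on_def by blast
    have "((\<lambda>s. p n (\<gamma> s)) has_field_derivative D (v s)) (at s)"
      using D \<gamma> by (intro has_field_derivative_along_curve) (auto simp: entire_curve_def)
    moreover have "((\<lambda>t. p n (\<eta> t)) has_field_derivative D (v s)) (at t)"
      using D \<eta> eq by (intro has_field_derivative_along_curve) (auto simp: entire_curve_def)
    ultimately show ?thesis by (simp add: DERIV_imp_deriv)
  qed
  with lim[OF \<gamma>, of s] lim[OF \<eta>, of t] show ?thesis
    by (simp add: LIMSEQ_unique)
qed

section \<open>Solutions of a holomorphic field and their Taylor coefficients\<close>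

text \<open>
  A holomorphic vector field \<open>F\<close> on \<open>\<complex>\<^sup>n\<close> that is complete, with a flow \<open>X\<close> for all complex times. No
  regularity of \<open>X\<close> in the initial point is assumed.
\<close>

locale complete_holomorphic_field =
  fixes F :: "complex^'n \<Rightarrow> complex^'n"
    and X :: "complex \<Rightarrow> complex^'n \<Rightarrow> complex^'n"
  assumes holomorphic_field: "holomorphic_map_on F UNIV"
    and flow: "complex_time_flow F X"
begin

lemma flow_zero [simp]: "X 0 z = z"
  using flow by (simp add: complex_time_flow_def)

lemma entire_curve_flow: "entire_curve (\<lambda>t. X t z) (\<lambda>t. F (X t z))"
  using flow by (simp add: complex_time_flow_def entire_curve_def)

lemma poly_entire_field: "poly_entire (\<lambda>z. F z $ i)"
  using holomorphic_field by (intro holomorphic_imp_poly_entire) (simp add: holomorphic_map_on_def)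

lemma continuous_on_field: "continuous_on S F"
proof -
  have "continuous_on UNIV (\<lambda>z. \<chi> i. F z $ i)"
    using holomorphic_field
    by (intro continuous_intros continuous_on_holomorphic_fun_on) (simp add: holomorphic_map_on_def)
  then show ?thesis by (auto intro: continuous_on_subset)
qed

lemma field_bounded_on:
  assumes "compact K"
  obtains M where "M > 0" "\<And>z. z \<in> K \<Longrightarrow> norm (F z) \<le> M"
  using compact_imp_bounded[OF compact_continuous_image[OF continuous_on_field assms]]
  unfolding bounded_pos by blast

text \<open>The derivative of \<open>G\<close> in the direction of the field: the Lie derivative along \<open>F\<close>.\<close>

definition lie_derivative :: "(complex^'n \<Rightarrow> complex) \<Rightarrow> complex^'n \<Rightarrow> complex" where
  "lie_derivative G z = deriv (\<lambda>h. G (z + h *s F z)) 0"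

lemma poly_entire_lie_derivative:
  assumes G: "poly_entire G"
  shows "poly_entire (lie_derivative G)"
  unfolding poly_entire_def
proof
  fix R :: real
  let ?K = "cball 0 R :: (complex^'n) set"
  obtain M where M: "M > 0" "\<And>z. z \<in> ?K \<Longrightarrow> norm (F z) \<le> M"
    using field_bounded_on[of ?K] by auto
  obtain N where N: "\<And>z. z \<in> cball 0 (R + M) \<Longrightarrow> norm (G z) \<le> N"
    using poly_entire_bounded[OF G, of "cball 0 (R + M)"] by auto
  have in_ball: "z + t *s F z \<in> cball 0 (R + M)" if z: "z \<in> ?K" and t: "norm t \<le> 1" for z t
  proof -
    have "norm (t *s F z) \<le> 1 * M"
      unfolding norm_vector_smult using t M z by (intro mult_mono) auto
    then show ?thesis using z norm_triangle_ineq[of z "t *s F z"] by simp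
  qed
  \<comment> \<open>The Lie derivative is the first Taylor coefficient of the family \<open>h \<mapsto> G (z + h *s F z)\<close>.\<close>
  have "poly_approximable_on ?K (\<lambda>z. (deriv ^^ 1) (\<lambda>h. G (z + h *s F z)) 0 / fact 1)"
  proof (rule poly_approximable_on_taylor_coeff[where R = 1 and \<delta> = 1 and M = N])
    show "(\<lambda>h. G (z + h *s F z)) holomorphic_on ball 0 1" for z
      using poly_entire_along_entire_curve[OF G entire_curve_line] by (rule holomorphic_on_subset) simp
    show "norm (G (z + t *s F z)) \<le> N" if "z \<in> ?K" "t \<in> ball 0 1" for z t
      using in_ball[of z t] that N by auto
    show "poly_approximable_on ?K (\<lambda>z. G (z + (0 + of_real s) *s F z))" if "0 < s" "s < 1" for s :: real
    proof (rule poly_approximable_on_compose)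
      show "poly_approximable_on (cball 0 (R + M)) G"
        using G by (simp add: poly_entire_def)
      show "poly_approximable_on ?K (\<lambda>z. (z + (0 + of_real s) *s F z) $ i)" for i
        unfolding vector_add_component vector_smult_component
        by (intro poly_approximable_on_add poly_approximable_on_mult poly_approximable_on_const
            poly_approximable_on_coord poly_entire_approximable_on poly_entire_field) auto
      show "(\<lambda>z. z + (0 + of_real s) *s F z) ` ?K \<subseteq> cball 0 (R + M)"
        using that in_ball by (intro image_subsetI) (simp del: mem_cball)
    qed simp
  qed auto
  moreover have "(\<lambda>z. (deriv ^^ 1) (\<lambda>h. G (z + h *s F z)) 0 / fact 1) = lie_derivative G"
    by (simp add: lie_derivative_def fun_eq_iff)
  ultimately show "poly_approximable_on ?K (lie_derivative G)"
    by (simp only:)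
qed

text \<open>
  All time derivatives along a solution are entire functions of the current position. At time \<open>0\<close> this
  expresses the Taylor coefficients of a solution through its initial value.
\<close>

lemma higher_deriv_along_solution:
  assumes y: "entire_curve y (\<lambda>t. F (y t))" and G: "poly_entire G"
  shows "poly_entire ((lie_derivative ^^ k) G)"
    and "(deriv ^^ k) (\<lambda>t. G (y t)) = (\<lambda>t. (lie_derivative ^^ k) G (y t))"
proof (induction k)
  case (Suc k)
  show "poly_entire ((lie_derivative ^^ Suc k) G)"
    using poly_entire_lie_derivative[OF Suc.IH(1)] by simp
  have "deriv (\<lambda>t. (lie_derivative ^^ k) G (y t)) t = lie_derivative ((lie_derivative ^^ k) G) (y t)" for t
    unfolding lie_derivative_def[of "(lie_derivative ^^ k) G"]
    using deriv_poly_entire_along_entire_curves[OF Suc.IH(1) y entire_curve_line[of "y t" "F (y t)"], of t 0]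
    by simp
  then show "(deriv ^^ Suc k) (\<lambda>t. G (y t)) = (\<lambda>t. (lie_derivative ^^ Suc k) G (y t))"
    by (simp add: Suc.IH(2) fun_eq_iff)
qed (use G in auto)

lemma solution_unique:
  assumes y: "entire_curve y (\<lambda>t. F (y t))" and w: "entire_curve w (\<lambda>t. F (w t))"
    and eq: "y 0 = w 0"
  shows "y t = w t"
proof -
  have "y t $ i = w t $ i" for i
  proof -
    have G: "poly_entire (\<lambda>z. z $ i)"
      by (intro holomorphic_imp_poly_entire holomorphic_fun_on_coord)
    have "(deriv ^^ k) (\<lambda>t. y t $ i) 0 = (deriv ^^ k) (\<lambda>t. w t $ i) 0" for k
      using fun_cong[OF higher_deriv_along_solution(2)[OF y G]]
        fun_cong[OF higher_deriv_along_solution(2)[OF w G]] eq by simp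
    then show ?thesis
      using holomorphic_fun_eq_on_connected[OF poly_entire_along_entire_curve[OF G y]
          poly_entire_along_entire_curve[OF G w] open_UNIV connected_UNIV, of 0 t] by simp
  qed
  then show ?thesis by (simp add: vec_eq_iff)
qed

lemma flow_add: "X (s + t) z = X s (X t z)"
proof -
  have "X (t + s) z = X s (X t z)"
    using solution_unique[OF entire_curve_shift[OF entire_curve_flow] entire_curve_flow, of t z "X t z" s]
    by simp
  then show ?thesis by (simp add: add.commute)
qed


section \<open>Dependence of the flow on the initial point\<close>

text \<open>
  As long as the solution stays in the ball its speed is at most \<open>M\<close>, and before the first time at
  which it could leave, it has travelled less than \<open>\<rho>\<close>.
\<close>

lemma flow_displacement_le:
  assumes \<rho>: "\<rho> > 0" and M: "\<And>w. w \<in> cball z \<rho> \<Longrightarrow> norm (F w) \<le> M" and t: "norm t * M < \<rho>"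
  shows "norm (X t z - z) \<le> M * norm t"
proof -
  define y where "y u = X (of_real u * t) z" for u :: real
  have y0: "y 0 = z" by (simp add: y_def)
  have deriv: "(y has_vector_derivative t *s F (y u)) (at u)" for u
  proof -
    have "((\<lambda>u. complex_of_real u * t) has_derivative (\<lambda>h. of_real h * t)) (at u)"
      by (auto intro!: derivative_eq_intros)
    moreover have "((\<lambda>s. X s z) has_derivative (\<lambda>h. h *s F (y u))) (at (of_real u * t))"
      using entire_curve_flow by (simp add: entire_curve_def y_def)
    ultimately have "(y has_derivative (\<lambda>h. (of_real h * t) *s F (y u))) (at u)"
      unfolding y_def by (rule has_derivative_compose)
    moreover have "(\<lambda>h. (of_real h * t) *s F (y u)) = (\<lambda>h. h *\<^sub>R (t *s F (y u)))"
      unfolding fun_eq_iff vec_eq_iff vector_scaleR_component vector_smult_component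
      by (simp add: scaleR_conv_of_real mult.assoc)
    ultimately show ?thesis
      by (simp add: has_vector_derivative_def)
  qed
  have cont: "continuous_on S y" for S
    using deriv has_vector_derivative_continuous continuous_at_imp_continuous_on by blast
  have bound: "norm (y u - z) \<le> M * norm t * u"
    if u: "0 < u" and in_ball: "\<And>s. 0 < s \<Longrightarrow> s < u \<Longrightarrow> y s \<in> cball z \<rho>" for u
  proof -
    have "norm (y u - y 0) \<le> M * norm t * u - M * norm t * 0"
    proof (rule differentiable_bound_general[OF u cont])
      show "((\<lambda>u. M * norm t * u) has_vector_derivative (M * norm t)) (at s)" for s
        by (auto intro!: derivative_eq_intros simp: has_vector_derivative_def)
      show "norm (t *s F (y s)) \<le> M * norm t" if "0 < s" "s < u" for s
        unfolding norm_vector_smult using M[OF in_ball[OF that]]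
        by (simp add: mult.commute[of M] mult_left_mono)
    qed (auto intro!: continuous_intros deriv)
    then show ?thesis by (simp add: y0)
  qed
  have inside: "norm (y s - z) < \<rho>" if "0 \<le> s" "s \<le> 1" for s
  proof (rule ccontr)
    define B where "B = {0..1} \<inter> (\<lambda>s. norm (y s - z)) -` {\<rho>..}"
    assume "\<not> norm (y s - z) < \<rho>"
    with that have "s \<in> B" by (simp add: B_def)
    have "closed B"
      unfolding B_def by (intro continuous_closed_preimage continuous_intros cont closed_atLeastAtMost closed_atLeast)
    moreover have "bdd_below B" by (auto simp: B_def bdd_below_def)
    ultimately have Inf: "Inf B \<in> B" using \<open>s \<in> B\<close> by (intro closed_contains_Inf) auto
    have least: "norm (y u - z) < \<rho>" if "0 \<le> u" "u < Inf B" for u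
      using that Inf cInf_lower[OF _ \<open>bdd_below B\<close>, of u] by (force simp: B_def)
    have u: "0 < Inf B" "Inf B \<le> 1"
      using Inf \<rho> y0 by (auto simp: B_def order_less_le)
    have "norm (y (Inf B) - z) \<le> M * norm t * Inf B"
      using least by (intro bound u) (auto simp: dist_norm norm_minus_commute less_imp_le)
    also have "\<dots> \<le> M * norm t * 1"
    proof -
      have "0 \<le> M" using M[of z] \<rho> by (meson centre_in_cball less_imp_le norm_ge_zero order_trans)
      then show ?thesis using u by (intro mult_left_mono) auto
    qed
    also have "\<dots> < \<rho>" using t by (simp add: mult.commute)
    finally show False using Inf by (simp add: B_def)
  qed
  have "norm (y 1 - z) \<le> M * norm t * 1"
    using inside by (intro bound) (auto simp: dist_norm norm_minus_commute less_imp_le)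
  then show ?thesis by (simp add: y_def)
qed

text \<open>
  On a ball the flow is uniformly bounded for short times, so its Taylor series in the time variable,
  whose coefficients are entire in the initial point, converges uniformly.
\<close>

lemma flow_short_time:
  obtains r where "r > 0"
    "\<And>t z. norm t < r \<Longrightarrow> z \<in> cball 0 R \<Longrightarrow> norm (X t z - z) \<le> 1"
    "\<And>t i. norm t < r \<Longrightarrow> poly_approximable_on (cball 0 R) (\<lambda>z. X t z $ i)"
proof -
  obtain M where M: "M > 0" "\<And>z. z \<in> cball 0 (R + 1) \<Longrightarrow> norm (F z) \<le> M"
    using field_bounded_on[of "cball 0 (R + 1)"] by auto
  define r where "r = 1 / M"
  have near: "norm (X t z - z) \<le> 1" if t: "norm t < r" and z: "z \<in> cball 0 R" for t z
  proof -
    have "w \<in> cball 0 (R + 1)" if "w \<in> cball z 1" for w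
      using that z norm_triangle_ineq[of z "w - z"] by (simp add: dist_norm norm_minus_commute)
    moreover have tM: "norm t * M < 1" using t M(1) by (simp add: r_def field_simps)
    ultimately have "norm (X t z - z) \<le> M * norm t"
      using M(2) by (intro flow_displacement_le[of 1]) auto
    then show ?thesis using tM by (simp add: mult.commute)
  qed
  have "poly_approximable_on (cball 0 R) (\<lambda>z. X t z $ i)" if t: "norm t < r" for t i
  proof -
    have G: "poly_entire (\<lambda>z. z $ i)"
      by (intro holomorphic_imp_poly_entire holomorphic_fun_on_coord)
    show ?thesis
    proof (rule poly_approximable_on_taylor_sum[where h = "\<lambda>z t. X t z $ i" and \<tau> = "\<lambda>_. t"
          and R = r and R' = "norm t" and M = "R + 1" and a = 0])
      show "(\<lambda>s. X s z $ i) holomorphic_on ball 0 r" for z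
        using poly_entire_along_entire_curve[OF G entire_curve_flow] by (rule holomorphic_on_subset) simp
      show "norm (X s z $ i) \<le> R + 1" if "z \<in> cball 0 R" "s \<in> ball 0 r" for z s
      proof -
        have "norm (X s z $ i) \<le> norm (X s z)" by (rule Finite_Cartesian_Product.norm_nth_le)
        also have "\<dots> \<le> norm (X s z - z) + norm z"
          using norm_triangle_ineq[of "X s z - z" z] by simp
        also have "\<dots> \<le> R + 1" using near[of s z] that by simp
        finally show ?thesis .
      qed
      show "poly_approximable_on (cball 0 R) (\<lambda>z. (deriv ^^ k) (\<lambda>s. X s z $ i) 0 / fact k)" for k
      proof -
        have "(deriv ^^ k) (\<lambda>s. X s z $ i) 0 / fact k =
            (1 / fact k) * (lie_derivative ^^ k) (\<lambda>z. z $ i) z" for z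
          using fun_cong[OF higher_deriv_along_solution(2)[OF entire_curve_flow G], of k z 0] by simp
        moreover have "poly_approximable_on (cball 0 R) (\<lambda>z. (1 / fact k) * (lie_derivative ^^ k) (\<lambda>z. z $ i) z)"
          using higher_deriv_along_solution(1)[OF entire_curve_flow G, of k]
          by (intro poly_approximable_on_mult poly_approximable_on_const) (auto simp: poly_entire_def)
        ultimately show ?thesis by (simp only:)
      qed
    qed (use t in \<open>auto intro: poly_approximable_on_const\<close>)
  qed
  then show ?thesis using that[of r] near M(1) by (auto simp: r_def)
qed

lemma flow_iterate_short_times:
  assumes "N > 0"
  shows "X (of_real (real (Suc k) / real N) * t) z = X (t / of_nat N) (X (of_real (real k / real N) * t) z)"
proof -
  have "of_real (real (Suc k) / real N) * t = t / of_nat N + of_real (real k / real N) * t"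
    using assms by (simp add: field_simps)
  then show ?thesis by (simp only: flow_add)
qed

text \<open>
  The segment from \<open>0\<close> to \<open>t\<close> is cut into \<open>N\<close> steps, short for a ball that contains a neighbourhood of
  the trajectory of \<open>z0\<close>.
\<close>

lemma isCont_flow: "isCont (X t) z0"
proof -
  have "bounded ((\<lambda>u. X (of_real u * t) z0) ` {0..1})"
    by (intro compact_imp_bounded compact_continuous_image continuous_on_compose2[OF entire_curve_continuous_on[OF entire_curve_flow, of UNIV]]
        continuous_intros) auto
  then obtain R where R: "\<And>u. 0 \<le> u \<Longrightarrow> u \<le> 1 \<Longrightarrow> norm (X (of_real u * t) z0) \<le> R"
    unfolding bounded_iff by force
  obtain r where r: "r > 0"
    "\<And>t i. norm t < r \<Longrightarrow> poly_approximable_on (cball 0 (R + 1)) (\<lambda>z. X t z $ i)"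
    using flow_short_time[of "R + 1"] by metis
  obtain N where N: "norm t / r < real N" "N > 0"
    using reals_Archimedean2[of "norm t / r"] r(1)
    by (metis divide_nonneg_pos gr0I norm_ge_zero not_less of_nat_0)
  have tN: "norm (t / of_nat N) < r"
    using N r(1) by (simp add: norm_divide field_simps)
  have short: "isCont (X (t / of_nat N)) w" if "norm w \<le> R" for w
  proof -
    have "continuous_on (cball 0 (R + 1)) (\<lambda>z. \<chi> i. X (t / of_nat N) z $ i)"
      using r(2)[OF tN] by (intro continuous_intros continuous_on_poly_approximable_on)
    moreover have "w \<in> interior (cball 0 (R + 1))"
      using that by simp
    ultimately show ?thesis
      using continuous_on_interior by fastforce
  qed
  have "isCont (X (of_real (real k / real N) * t)) z0" if "k \<le> N" for k
    using that
  proof (induction k)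
    case 0
    have "X 0 = (\<lambda>z. z)" by (simp add: fun_eq_iff)
    then show ?case by simp
  next
    case (Suc k)
    have "norm (X (of_real (real k / real N) * t) z0) \<le> R"
      using Suc.prems by (intro R) auto
    then have "isCont (\<lambda>z. X (t / of_nat N) (X (of_real (real k / real N) * t) z)) z0"
      using Suc by (intro isCont_o2[OF _ short]) auto
    then show ?case
      by (simp only: flow_iterate_short_times[OF N(2)])
  qed
  from this[of N] show ?thesis using N(2) by simp
qed

lemma continuous_on_flow: "continuous_on S (\<lambda>(t, z). X t z)"
proof -
  have "isCont (\<lambda>p. X (fst p) (snd p)) (t0, z0)" for t0 z0
  proof -
    let ?p = "X t0 z0"
    obtain M where M: "M > 0" "\<And>z. z \<in> cball 0 (norm ?p + 2) \<Longrightarrow> norm (F z) \<le> M"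
      using field_bounded_on[of "cball 0 (norm ?p + 2)"] by auto
    have snd: "((\<lambda>p. X t0 (snd p)) \<longlongrightarrow> ?p) (at (t0, z0))"
      by (rule isCont_tendsto_compose[OF isCont_flow]) (auto intro!: tendsto_eq_intros)
    have fst: "((\<lambda>p. norm (fst p - t0)) \<longlongrightarrow> 0) (at (t0, z0))"
      by (auto intro!: tendsto_eq_intros)
    have "((\<lambda>p. X (fst p) (snd p) - X t0 (snd p)) \<longlongrightarrow> 0) (at (t0, z0))"
    proof (rule Lim_null_comparison)
      have "\<forall>\<^sub>F p in at (t0, z0). dist (X t0 (snd p)) ?p < 1"
        using tendstoD[OF snd, of 1] by simp
      moreover have "\<forall>\<^sub>F p in at (t0, z0). norm (fst p - t0) < 1 / M"
        using order_tendstoD(2)[OF fst, of "1 / M"] M(1) by simp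
      ultimately show "\<forall>\<^sub>F p in at (t0, z0). norm (X (fst p) (snd p) - X t0 (snd p)) \<le> M * norm (fst p - t0)"
      proof eventually_elim
        case (elim p)
        have "w \<in> cball 0 (norm ?p + 2)" if "w \<in> cball (X t0 (snd p)) 1" for w
          using that elim(1) norm_triangle_ineq[of "w - X t0 (snd p)" "X t0 (snd p) - ?p"]
            norm_triangle_ineq[of "w - ?p" ?p]
          by (simp add: dist_norm norm_minus_commute)
        moreover have "norm (fst p - t0) * M < 1" using elim(2) M(1) by (simp add: field_simps)
        ultimately have "norm (X (fst p - t0) (X t0 (snd p)) - X t0 (snd p)) \<le> M * norm (fst p - t0)"
          using M(2) by (intro flow_displacement_le[of 1]) auto
        then show ?case using flow_add[of "fst p - t0" t0 "snd p"] by simp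
      qed
      show "((\<lambda>p. M * norm (fst p - t0)) \<longlongrightarrow> 0) (at (t0, z0))"
        using tendsto_mult_right_zero[OF fst] by simp
    qed
    from tendsto_add[OF this snd] show ?thesis by (simp add: isCont_def)
  qed
  then show ?thesis
    unfolding case_prod_beta by (intro continuous_at_imp_continuous_on) auto
qed

lemma compact_flow_image:
  assumes "compact T" "compact K"
  shows "compact ((\<lambda>(t, z). X t z) ` (T \<times> K))"
  by (intro compact_continuous_image continuous_on_flow compact_Times assms)

text \<open>
  The time-\<open>t\<close> map is entire: it is a composition of short-time maps, each taken on a ball containing
  all trajectories that start in \<open>K\<close>, up to time \<open>t\<close> along the segment from \<open>0\<close>.
\<close>

lemma poly_approximable_on_flow:
  assumes K: "compact K"
  shows "poly_approximable_on K (\<lambda>z. X t z $ i)"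
proof -
  let ?T = "(\<lambda>u. of_real u * t) ` {0..1::real}"
  have "compact ?T"
    by (intro compact_continuous_image continuous_intros) auto
  from compact_imp_bounded[OF compact_flow_image[OF this K]]
  obtain R where R: "\<forall>u\<in>{0..1}. \<forall>z\<in>K. norm (X (of_real u * t) z) \<le> R"
    unfolding bounded_iff by auto
  obtain r where r: "r > 0"
    "\<And>t i. norm t < r \<Longrightarrow> poly_approximable_on (cball 0 R) (\<lambda>z. X t z $ i)"
    using flow_short_time[of R] by metis
  obtain N where N: "norm t / r < real N" "N > 0"
    using reals_Archimedean2[of "norm t / r"] r(1)
    by (metis divide_nonneg_pos gr0I norm_ge_zero not_less of_nat_0)
  have tN: "norm (t / of_nat N) < r"
    using N r(1) by (simp add: norm_divide field_simps)
  have "poly_approximable_on K (\<lambda>z. X (of_real (real k / real N) * t) z $ i)" if "k \<le> N" for k i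
    using that
  proof (induction k arbitrary: i)
    case 0
    then show ?case by (simp add: poly_approximable_on_coord)
  next
    case (Suc k)
    have "real k / real N \<in> {0..1}" using Suc.prems by auto
    then have "X (of_real (real k / real N) * t) ` K \<subseteq> cball 0 R"
      using R by (intro image_subsetI) (simp del: of_real_divide)
    then have "poly_approximable_on K (\<lambda>z. X (t / of_nat N) (X (of_real (real k / real N) * t) z) $ i)"
      using Suc by (intro poly_approximable_on_compose[OF r(2)[OF tN] _ K]) auto
    then show ?case
      by (simp only: flow_iterate_short_times[OF N(2)])
  qed
  from this[of N] show ?thesis using N(2) by simp
qed

end

section \<open>Invariant domains of attracting fields\<close>

lemma poly_approximable_on_small_cball:
  fixes f :: "complex^'n \<Rightarrow> complex"
  assumes f: "holomorphic_fun_on f U" "open U" and "0 \<in> U"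
  obtains r where "r > 0" "poly_approximable_on (cball 0 r) f"
proof -
  obtain e where e: "e > 0" "cball 0 e \<subseteq> U"
    using assms(2,3) by (meson open_contains_cball)
  define R where "R = e / CARD('n)"
  have R: "R > 0" using e(1) by (simp add: R_def)
  have "polydisc R \<subseteq> U"
  proof
    fix z :: "complex^'n" assume "z \<in> polydisc R"
    then have "(\<Sum>i\<in>UNIV. norm (z $ i)) \<le> (\<Sum>i\<in>(UNIV :: 'n set). R)"
      by (intro sum_mono) (simp add: polydisc_def)
    then have "norm z \<le> e"
      using norm_le_sum_components[of z] by (simp add: R_def)
    then show "z \<in> U" using e(2) by auto
  qed
  then have "poly_approximable_on (polydisc (R / 2)) f"
    using R by (intro poly_approximable_on_polydisc[OF f]) auto
  then show ?thesis
    using R by (intro that[of "R / 2"] poly_approximable_on_subset[OF _ cball_subset_polydisc]) simp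
qed

context complete_holomorphic_field
begin

text \<open>
  By Lyapunov stability a trajectory that has once come close to the origin stays close, so pointwise
  attraction is uniform on compact sets.
\<close>

lemma uniform_attraction:
  assumes attr: "globally_attracting_origin F X" and K: "compact K" and r: "r > 0"
  obtains T where "T \<ge> 0" "\<And>t z. t \<ge> T \<Longrightarrow> z \<in> K \<Longrightarrow> norm (X (complex_of_real t) z) < r"
proof -
  obtain \<delta> where \<delta>: "\<delta> > 0"
    "\<And>z t. norm z < \<delta> \<Longrightarrow> t \<ge> 0 \<Longrightarrow> norm (X (complex_of_real t) z) < r"
    using attr r unfolding globally_attracting_origin_def lyapunov_stable_origin_def by metis
  define U where "U s = {z. norm (X (complex_of_real s) z) < \<delta>}" for s
  have "open (U s)" for s
    unfolding U_def
    by (intro open_Collect_less continuous_intros continuous_at_imp_continuous_on) (simp add: isCont_flow)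
  moreover have "K \<subseteq> (\<Union>s\<in>{0..}. U s)"
  proof
    fix z
    have "((\<lambda>t. X (complex_of_real t) z) \<longlongrightarrow> 0) at_top"
      using attr by (simp add: globally_attracting_origin_def)
    then have "\<forall>\<^sub>F t in at_top. dist (X (complex_of_real t) z) 0 < \<delta>"
      using \<delta>(1) by (rule tendstoD)
    then have "\<forall>\<^sub>F t in at_top. t \<ge> 0 \<and> norm (X (complex_of_real t) z) < \<delta>"
      using eventually_ge_at_top[of "0::real"] by eventually_elim simp
    then obtain t where "t \<ge> 0" "norm (X (complex_of_real t) z) < \<delta>"
      using eventually_happens'[OF trivial_limit_at_top_linorder] by blast
    then show "z \<in> (\<Union>s\<in>{0..}. U s)"
      unfolding U_def by auto
  qed
  ultimately obtain S where S: "S \<subseteq> {0..}" "finite S" "K \<subseteq> (\<Union>s\<in>S. U s)"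
    using compactE_image[OF K, of "{0..}" U] by metis
  define T where "T = Max (insert 0 S)"
  have T: "T \<ge> 0" "\<And>s. s \<in> S \<Longrightarrow> s \<le> T"
    using S(2) by (auto simp: T_def)
  have "norm (X (complex_of_real t) z) < r" if t: "t \<ge> T" and z: "z \<in> K" for t z
  proof -
    obtain s where s: "s \<in> S" "norm (X (complex_of_real s) z) < \<delta>"
      using S(3) z by (auto simp: U_def)
    have "norm (X (complex_of_real (t - s)) (X (complex_of_real s) z)) < r"
      using T(2)[OF s(1)] t by (intro \<delta>(2) s(2)) simp
    then show ?thesis by (simp flip: flow_add of_real_add)
  qed
  with T(1) show ?thesis using that by blast
qed

text \<open>
  The functions \<open>z \<mapsto> f (X t z)\<close> on \<open>K\<close> are limits of polynomials for \<open>t\<close> large, and this property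
  propagates backwards in time to \<open>t = 0\<close>.
\<close>

lemma poly_approximable_on_invariant_domain:
  assumes attr: "globally_attracting_origin F X"
    and \<Omega>: "open \<Omega>" "0 \<in> \<Omega>"
    and inv: "\<And>t::real. t \<ge> 0 \<Longrightarrow> X (complex_of_real t) ` \<Omega> \<subseteq> \<Omega>"
    and f: "holomorphic_fun_on f \<Omega>" and K: "compact K" "K \<subseteq> \<Omega>"
  shows "poly_approximable_on K f"
proof -
  obtain \<rho> where \<rho>: "\<rho> > 0" "poly_approximable_on (cball 0 \<rho>) f"
    using poly_approximable_on_small_cball[OF f \<Omega>] by blast
  obtain T where T: "T \<ge> 0" "\<And>t z. t \<ge> T \<Longrightarrow> z \<in> K \<Longrightarrow> norm (X (complex_of_real t) z) < \<rho>"
    using uniform_attraction[OF attr K(1) \<rho>(1)] by blast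
  have late: "poly_approximable_on K (\<lambda>z. f (X (complex_of_real t) z))" if "t \<ge> T" for t
    using T(2)[OF that] poly_approximable_on_flow[OF K(1)]
    by (intro poly_approximable_on_compose[OF \<rho>(2) _ K(1)]) (auto simp: less_imp_le)
  \<comment> \<open>The trajectories of \<open>K\<close> up to time \<open>T\<close> have a compact neighbourhood in \<open>\<Omega>\<close>. Hence there is one
      radius \<open>r\<close> such that \<open>t \<mapsto> f (X t z)\<close> is defined and bounded on the complex disc of radius \<open>r\<close>
      around every \<open>\<tau> \<in> [0, T]\<close>, for all \<open>z \<in> K\<close>.\<close>
  define C where "C = (\<lambda>(t, z). X t z) ` (complex_of_real ` {0..T} \<times> K)"
  have "compact C"
    unfolding C_def by (intro compact_flow_image K compact_continuous_image continuous_intros) auto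
  moreover have "C \<subseteq> \<Omega>"
    using inv K(2) by (auto simp: C_def image_subset_iff)
  ultimately obtain e where e: "e > 0" "(\<Union>w\<in>C. cball w e) \<subseteq> \<Omega>"
    using compact_subset_open_imp_cball_epsilon_subset \<Omega>(1) by metis
  let ?D = "\<Union>w\<in>C. cball w e"
  have D: "compact ?D" using \<open>compact C\<close> by (rule compact_minkowski_sum_cball)
  obtain M where M: "M > 0" "\<And>z. z \<in> ?D \<Longrightarrow> norm (F z) \<le> M"
    using field_bounded_on[OF D] by blast
  have "bounded (f ` ?D)"
    using continuous_on_subset[OF continuous_on_holomorphic_fun_on[OF f] e(2)] D
    by (intro compact_imp_bounded compact_continuous_image)
  then obtain N where N: "\<And>z. z \<in> ?D \<Longrightarrow> norm (f z) \<le> N"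
    unfolding bounded_iff by (meson image_eqI)
  define r where "r = e / M"
  have r: "r > 0" using e(1) M(1) by (simp add: r_def)
  have in_D: "X t z \<in> ?D" if \<tau>: "0 \<le> \<tau>" "\<tau> \<le> T" and z: "z \<in> K" and t: "t \<in> ball (complex_of_real \<tau>) r" for \<tau> t z
  proof -
    let ?w = "X (complex_of_real \<tau>) z"
    have w: "?w \<in> C" using \<tau> z by (auto simp: C_def)
    have small: "norm (t - complex_of_real \<tau>) * M < e"
      using t M(1) by (simp add: r_def dist_norm norm_minus_commute field_simps)
    have "norm (X (t - complex_of_real \<tau>) ?w - ?w) \<le> M * norm (t - complex_of_real \<tau>)"
      using w M(2) by (intro flow_displacement_le[OF e(1) _ small]) blast
    with small have "norm (X t z - ?w) < e"
      by (simp add: mult.commute flip: flow_add)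
    then have "X t z \<in> cball ?w e"
      by (simp add: dist_norm norm_minus_commute)
    with w show ?thesis by blast
  qed
  have step: "poly_approximable_on K (\<lambda>z. f (X (complex_of_real t) z))"
    if \<tau>: "0 \<le> \<tau>" "\<tau> \<le> T" "\<bar>t - \<tau>\<bar> < r"
      and later: "\<And>s. s > \<tau> \<Longrightarrow> poly_approximable_on K (\<lambda>z. f (X (complex_of_real s) z))" for t \<tau>
  proof -
    have hol: "(\<lambda>s. f (X s z)) holomorphic_on ball (complex_of_real \<tau>) r" if "z \<in> K" for z
    proof (rule holomorphic_fun_on_along_curve[OF f \<Omega>(1)])
      show "((\<lambda>s. X s z) has_derivative (\<lambda>h. h *s F (X s z))) (at s)" for s
        using entire_curve_flow by (simp add: entire_curve_def)
      show "X s z \<in> \<Omega>" if "s \<in> ball (complex_of_real \<tau>) r" for s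
        using in_D[OF \<tau>(1,2) \<open>z \<in> K\<close> that] e(2) by blast
    qed simp
    have bd: "norm (f (X s z)) \<le> N" if "z \<in> K" "s \<in> ball (complex_of_real \<tau>) r" for z s
      using N in_D[OF \<tau>(1,2) that] by blast
    have "poly_approximable_on K (\<lambda>z. f (X (complex_of_real \<tau> + of_real s) z))" if "0 < s" for s
      using later[of "\<tau> + s"] that by simp
    then have "poly_approximable_on K (\<lambda>z. (deriv ^^ k) (\<lambda>s. f (X s z)) (complex_of_real \<tau>) / fact k)" for k
      by (intro poly_approximable_on_taylor_coeff[OF K(1) r hol bd zero_less_one]) auto
    then show ?thesis
      using \<tau>(3) by (intro poly_approximable_on_taylor_sum[OF K(1) _ \<tau>(3) hol bd _ poly_approximable_on_const])
        (auto simp flip: of_real_diff)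
  qed
  have "\<forall>t. 0 \<le> t \<longrightarrow> T - real n * (r / 2) \<le> t \<longrightarrow>
      poly_approximable_on K (\<lambda>z. f (X (complex_of_real t) z))" for n
  proof (induction n)
    case 0
    then show ?case using late by simp
  next
    case (Suc n)
    show ?case
    proof (intro allI impI)
      fix t :: real assume t: "0 \<le> t" "T - real (Suc n) * (r / 2) \<le> t"
      show "poly_approximable_on K (\<lambda>z. f (X (complex_of_real t) z))"
      proof (cases "T \<le> t")
        case True
        then show ?thesis by (rule late)
      next
        case False
        \<comment> \<open>The centre must not exceed \<open>T\<close>, since \<open>r\<close> is a valid radius only on \<open>[0, T]\<close>.\<close>
        define \<tau> where "\<tau> = min T (t + r / 2)"
        have "T - real n * (r / 2) \<le> T"
          using r by simp
        moreover have "T - real n * (r / 2) \<le> t + r / 2"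
          using t(2) by (simp add: algebra_simps add_divide_distrib)
        ultimately have ge: "T - real n * (r / 2) \<le> \<tau>"
          by (simp add: \<tau>_def)
        have \<tau>: "0 \<le> \<tau>" "\<tau> \<le> T" "\<bar>t - \<tau>\<bar> < r"
          using t(1) r False T(1) by (auto simp: \<tau>_def)
        show ?thesis
        proof (rule step[OF \<tau>])
          fix s assume "s > \<tau>"
          then have "0 \<le> s" "T - real n * (r / 2) \<le> s"
            using \<tau>(1) ge by auto
          then show "poly_approximable_on K (\<lambda>z. f (X (complex_of_real s) z))"
            using Suc.IH by blast
        qed
      qed
    qed
  qed
  moreover obtain n where "T / (r / 2) < real n"
    using reals_Archimedean2 by blast
  then have "T - real n * (r / 2) \<le> 0"
    using r by (simp add: field_simps)
  ultimately have "poly_approximable_on K (\<lambda>z. f (X (complex_of_real 0) z))"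
    by blast
  then show ?thesis by simp
qed

end

theorem theorem1p4:
  fixes F :: "complex^'n \<Rightarrow> complex^'n"
    and X :: "complex \<Rightarrow> complex^'n \<Rightarrow> complex^'n"
    and \<Omega> :: "(complex^'n) set"
  assumes "holomorphic_map_on F UNIV"
    and "complex_time_flow F X"
    and "globally_attracting_origin F X"
    and "domain_Cn \<Omega>"
    and "0 \<in> \<Omega>"
    and "\<And>t::real. t \<ge> 0 \<Longrightarrow> X (complex_of_real t) ` \<Omega> \<subseteq> \<Omega>"
  shows "runge_domain \<Omega>"
proof -
  interpret complete_holomorphic_field F X
    using assms(1,2) by unfold_locales
  have "poly_approximable_on K f" if "holomorphic_fun_on f \<Omega>" "compact K" "K \<subseteq> \<Omega>" for f K
    using assms(4) by (intro poly_approximable_on_invariant_domain[OF assms(3) _ assms(5,6) that])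
      (simp add: domain_Cn_def)
  then show ?thesis
    using assms(4) unfolding runge_domain_def poly_approximable_on_def by blast
qed

end
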